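(* Suppose that $\bar x$ is a local minimizer of the problem "minimize $J(x)$ subject to $x\in C$" such that $$J(x)\ge J(\bar x)+\frac c2\|x-\bar x\|_X^2\qquad\forall x\in C\cap B_\varepsilon^X(\bar x)$$ holds for some $c\ge 0$ and some $\varepsilon>0$. Assume further that one of the following conditions is satisfied. (i) The map $h\mapsto J''(\bar x)h^2$ is weak-$\star$ upper semicontinuous. (ii) The set $C$ satisfies the Mosco regularity condition (MRC) in $(\bar x,J'(\bar x))\in C\times -\mathcal N_C^\star(\bar x)$. Then $$Q_C^{\bar x,J'(\bar x)}(h)+J''(\bar x)h^2\ge c\,\|h\|_X^2\qquad\forall h\in\mathcal K_C^\star(\bar x,J'(\bar x)).$$
   Context: Standing assumptions: $X$ is the topological dual of a separable Banach space $Y$; $\iota:Y\to X^\star$ is the canonical embedding; $C\subset X$ is closed and non-empty; $\bar x\in C$ is fixed; $B_\varepsilon^X(\bar x)$ is the closed ball of radius $\varepsilon$ around $\bar x$. The function $J:C\to\mathbb R$ is such that there exist $J'(\bar x)\in\iota(Y)$ and a bounded bilinear form $J''(\bar x):X\times X\to\mathbb R$ with $$\lim_{k\to\infty}\frac{J(\bar x+t_kh_k)-J(\bar x)-t_kJ'(\bar x)h_k-\frac12t_k^2J''(\bar x)h_k^2}{t_k^2}=0$$ for all $\{h_k\}\subset X$, $\{t_k\}\subset\mathbb R^+$ with $t_k\searrow0$, $h_k\stackrel{\star}{\rightharpoonup}h\in X$ (weak-$\star$ convergence) and $\bar x+t_kh_k\in C$. Here $J'(\bar x)h:=\langle J'(\bar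 x),h\rangle$ and $J''(\bar x)h^2:=J''(\bar x)(h,h)$. For $x\in C$: the weak-$\star$ outer tangent cone is $\mathcal T_C^\star(x):=\{h\in X\mid\exists t_k\searrow0,\ \exists x_k\in C:\ (x_k-x)/t_k\stackrel{\star}{\rightharpoonup}h\}$; the weak-$\star$ normal cone is $\mathcal N_C^\star(x):=\{x^\star\in\iota(Y)\mid\langle x^\star,h\rangle\le0\ \forall h\in\mathcal T_C^\star(x)\}$; for $\varphi\in-\mathcal N_C^\star(x)$ the critical cone is $\mathcal K_C^\star(x,\varphi):=\mathcal T_C^\star(x)\cap\varphi^\perp$, where $\varphi^\perp=\{h\in X\mid\langle\varphi,h\rangle=0\}$. (In the situation of the claim, local optimality of $\bar x$ guarantees $J'(\bar x)\in-\mathcal N_C^\star(\bar x)$.) Directional curvature functional: for $x\in C$, $\varphi\in-\mathcal N_C^\star(x)$, define $Q_C^{x,\varphi}:\mathcal K_C^\star(x,\varphi)\to[-\infty,\infty]$ by $$Q_C^{x,\varphi}(h):=\inf\Big\{\liminf_{k\to\infty}\langle\varphi,r_k\rangle\ \Big|\ \{r_k\}\subset X,\{t_k\}\subset\mathbb R^+:\ t_k\searrow0,\ t_kr_k\stackrel{\star}{\rightharpoonup}0,\ x+t_kh+\tfrac12t_k^2r_k\in C\Big\}.$$ (MRC) in $(x,\varphi)\in C\times-\mathcal N_C^\star(x)$: for every $h\in\mathcal K_C^\star(x,\varphi)$ there exist $\{r_k\}\subset X$, $\{t_k\}\subset\mathbb R^+$ with $t_k\searrow0$, $t_kr_k\to0$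 strongly in $X$, $x+t_kh+\frac12t_k^2r_k\in C$ and $Q_C^{x,\varphi}(h)=\lim_{k\to\infty}\langle\varphi,r_k\rangle$. *)

theory Defs
  imports "HOL-Analysis.Analysis"
begin

text \<open>The dual of a normed space \<open>Y\<close> is the type \<open>'y \<Rightarrow>\<^sub>L real\<close> with the operator norm.\<close>

type_synonym 'y dual = "'y \<Rightarrow>\<^sub>L real"

definition canonical_embedding :: "'y::real_normed_vector \<Rightarrow> 'y dual dual" where
  "canonical_embedding y = Blinfun (\<lambda>x. blinfun_apply x y)"

lemma canonical_embedding_apply [simp]:
  "blinfun_apply (canonical_embedding y) x = blinfun_apply x y"
  unfolding canonical_embedding_def
  by (rule bounded_linear_Blinfun_apply[THEN fun_cong]) (rule blinfun.bounded_linear_left)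

text \<open>For scalar-valued operators, the topology of pointwise convergence is the weak-\<open>\<star>\<close> topology.\<close>

abbreviation weak_star_topology :: "'y::real_normed_vector dual topology" where
  "weak_star_topology \<equiv> strong_operator_topology"

abbreviation weak_star_tendsto ::
  "(nat \<Rightarrow> 'y::real_normed_vector dual) \<Rightarrow> 'y dual \<Rightarrow> bool" where
  "weak_star_tendsto x l \<equiv> limitin weak_star_topology x l sequentially"

lemma weak_star_tendsto_iff:
  "weak_star_tendsto x l \<longleftrightarrow> (\<forall>y. (\<lambda>k. blinfun_apply (x k) y) \<longlonglongrightarrow> blinfun_apply l y)"
proof
  assume L: "weak_star_tendsto x l"
  show "\<forall>y. (\<lambda>k. blinfun_apply (x k) y) \<longlonglongrightarrow> blinfun_apply l y"
  proof
    fix y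
    show "(\<lambda>k. blinfun_apply (x k) y) \<longlonglongrightarrow> blinfun_apply l y"
      using continuous_map_limit[OF strong_operator_topology_continuous_evaluation[of y] L]
      by (simp add: o_def)
  qed
next
  assume P: "\<forall>y. (\<lambda>k. blinfun_apply (x k) y) \<longlonglongrightarrow> blinfun_apply l y"
  have T: "(\<lambda>k. blinfun_apply (x k)) \<longlonglongrightarrow> blinfun_apply l"
    using P limitin_componentwise[of "\<lambda>_. euclidean" UNIV "\<lambda>k. blinfun_apply (x k)" "blinfun_apply l" sequentially]
    by (simp add: euclidean_product_topology)
  show "weak_star_tendsto x l"
    unfolding limitin_def
  proof (intro conjI allI impI)
    show "l \<in> topspace weak_star_topology"
      by (simp add: strong_operator_topology_topspace)
  next
    fix U :: "'a dual set" assume "openin weak_star_topology U \<and> l \<in> U"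
    then obtain V where V: "open V" "U = blinfun_apply -` V" "l \<in> U"
      by (auto simp: strong_operator_topology_def openin_pullback_topology)
    then have "\<forall>\<^sub>F k in sequentially. blinfun_apply (x k) \<in> V"
      using T by (auto simp: tendsto_def)
    then show "\<forall>\<^sub>F k in sequentially. x k \<in> U"
      using V by auto
  qed
qed

definition local_minimizer_on :: "('a::metric_space \<Rightarrow> real) \<Rightarrow> 'a set \<Rightarrow> 'a \<Rightarrow> bool" where
  "local_minimizer_on J C x \<longleftrightarrow>
     x \<in> C \<and> (\<exists>\<delta>>0. \<forall>z \<in> C \<inter> cball x \<delta>. J x \<le> J z)"

text \<open>Throughout, \<open>t\<^sub>k \<searrow> 0\<close> means \<open>t\<^sub>k > 0\<close> for all \<open>k\<close> and \<open>t\<^sub>k \<longrightarrow> 0\<close>; monotonicity is not required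
  (passing to a subsequence shows that requiring it would not change any of the notions below).\<close>

definition pos_null_seq :: "(nat \<Rightarrow> real) \<Rightarrow> bool" where
  "pos_null_seq t \<longleftrightarrow> (\<forall>k. 0 < t k) \<and> t \<longlonglongrightarrow> 0"

definition second_order_expansion ::
  "'y::real_normed_vector dual set \<Rightarrow> ('y dual \<Rightarrow> real) \<Rightarrow> 'y dual \<Rightarrow>
    'y dual dual \<Rightarrow> ('y dual \<Rightarrow> 'y dual \<Rightarrow> real) \<Rightarrow> bool" where
  "second_order_expansion C J x J1 J2 \<longleftrightarrow>
     (\<forall>h t hlim. pos_null_seq t \<longrightarrow> weak_star_tendsto h hlim \<longrightarrow>
        (\<forall>k. x + t k *\<^sub>R h k \<in> C) \<longrightarrow>
        (\<lambda>k. (J (x + t k *\<^sub>R h k) - J x - t k * blinfun_apply J1 (h k)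
                - 1/2 * (t k)\<^sup>2 * J2 (h k) (h k)) / (t k)\<^sup>2) \<longlonglongrightarrow> 0)"

definition weak_star_tangent_cone ::
  "'y::real_normed_vector dual set \<Rightarrow> 'y dual \<Rightarrow> 'y dual set" where
  "weak_star_tangent_cone C x =
     {h. \<exists>t z. pos_null_seq t \<and> (\<forall>k. z k \<in> C) \<and>
           weak_star_tendsto (\<lambda>k. (z k - x) /\<^sub>R t k) h}"

definition weak_star_normal_cone ::
  "'y::real_normed_vector dual set \<Rightarrow> 'y dual \<Rightarrow> 'y dual dual set" where
  "weak_star_normal_cone C x =
     {\<phi> \<in> range canonical_embedding. \<forall>h \<in> weak_star_tangent_cone C x. blinfun_apply \<phi> h \<le> 0}"

definition critical_cone ::
  "'y::real_normed_vector dual set \<Rightarrow> 'y dual \<Rightarrow> 'y dual dual \<Rightarrow> 'y dual set" where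
  "critical_cone C x \<phi> = weak_star_tangent_cone C x \<inter> {h. blinfun_apply \<phi> h = 0}"

text \<open>The infimum over the empty set is \<open>\<infinity>\<close>. The functional is only meaningful for
  \<open>x \<in> C\<close>, \<open>- \<phi> \<in> weak_star_normal_cone C x\<close> and \<open>h \<in> critical_cone C x \<phi>\<close>.\<close>

definition directional_curvature ::
  "'y::real_normed_vector dual set \<Rightarrow> 'y dual \<Rightarrow> 'y dual dual \<Rightarrow> 'y dual \<Rightarrow> ereal" where
  "directional_curvature C x \<phi> h =
     Inf {liminf (\<lambda>k. ereal (blinfun_apply \<phi> (r k))) | r t.
            pos_null_seq t \<and> weak_star_tendsto (\<lambda>k. t k *\<^sub>R r k) 0 \<and>
            (\<forall>k. x + t k *\<^sub>R h + (1/2 * (t k)\<^sup>2) *\<^sub>R r k \<in> C)}"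

definition mosco_regularity ::
  "'y::real_normed_vector dual set \<Rightarrow> 'y dual \<Rightarrow> 'y dual dual \<Rightarrow> bool" where
  "mosco_regularity C x \<phi> \<longleftrightarrow>
     x \<in> C \<and> - \<phi> \<in> weak_star_normal_cone C x \<and>
     (\<forall>h \<in> critical_cone C x \<phi>. \<exists>r t.
        pos_null_seq t \<and> (\<lambda>k. t k *\<^sub>R r k) \<longlonglongrightarrow> 0 \<and>
        (\<forall>k. x + t k *\<^sub>R h + (1/2 * (t k)\<^sup>2) *\<^sub>R r k \<in> C) \<and>
        (\<lambda>k. ereal (blinfun_apply \<phi> (r k))) \<longlonglongrightarrow> directional_curvature C x \<phi> h)"

text \<open>Semicontinuity is taken in the sequential sense. As a hypothesis this is implied by
  semicontinuity with respect to the weak-\<open>\<star>\<close> topology, see \<open>weak_star_usc_topological\<close>.\<close>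

definition weak_star_usc :: "('y::real_normed_vector dual \<Rightarrow> real) \<Rightarrow> bool" where
  "weak_star_usc q \<longleftrightarrow>
     (\<forall>h hlim. weak_star_tendsto h hlim \<longrightarrow> limsup (\<lambda>k. ereal (q (h k))) \<le> ereal (q hlim))"

lemma weak_star_usc_topological:
  fixes q :: "'y::real_normed_vector dual \<Rightarrow> real"
  assumes "\<And>a. openin weak_star_topology {h. q h < a}"
  shows "weak_star_usc q"
  unfolding weak_star_usc_def
proof (intro allI impI)
  fix h and hlim :: "'y dual"
  assume L: "weak_star_tendsto h hlim"
  have *: "limsup (\<lambda>k. ereal (q (h k))) \<le> ereal (q hlim) + ereal e" if "e > 0" for e
  proof (rule Limsup_bounded)
    have "\<forall>\<^sub>F k in sequentially. h k \<in> {h. q h < q hlim + e}"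
      using L assms[of "q hlim + e"] that unfolding limitin_def by (metis (mono_tags) less_add_same_cancel1 mem_Collect_eq)
    then show "\<forall>\<^sub>F k in sequentially. ereal (q (h k)) \<le> ereal (q hlim) + ereal e"
      by eventually_elim simp
  qed
  show "limsup (\<lambda>k. ereal (q (h k))) \<le> ereal (q hlim)"
    by (rule ereal_le_epsilon2) (use * in auto)
qed

end

theory Submission
  imports Defs
begin

text \<open>
  Let \<open>h\<close> be a critical direction and let \<open>(r\<^sub>k, t\<^sub>k)\<close> be admissible in the definition of the
  directional curvature. The points \<open>xbar + t\<^sub>k h + t\<^sub>k\<^sup>2/2 r\<^sub>k\<close> of \<open>C\<close> can be read as \<open>xbar + t\<^sub>k h\<^sub>k\<close>
  with the perturbed direction \<open>h\<^sub>k = h + t\<^sub>k/2 r\<^sub>k\<close>, which converges weakly-\<open>\<star>\<close> to \<open>h\<close>. Since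
  \<open>h\<close> is annihilated by \<open>J'\<close>, the first-order term \<open>t\<^sub>k J' h\<^sub>k\<close> is really of second order: it
  equals \<open>t\<^sub>k\<^sup>2/2 J' r\<^sub>k\<close>. Inserting the second-order expansion into the growth condition and
  dividing by \<open>t\<^sub>k\<^sup>2/2\<close> therefore gives
  \<open>c \<parallel>h\<^sub>k\<parallel>\<^sup>2 \<le> J' r\<^sub>k + J''(h\<^sub>k, h\<^sub>k) + o(1)\<close> (\<open>growth_along_curve\<close>).

  Growth holds only on a ball, so \<open>t\<^sub>k h\<^sub>k\<close> must tend to \<open>0\<close> in norm. This is where
  completeness of the predual enters: weakly-\<open>\<star>\<close> convergent sequences are bounded, by the
  Banach--Steinhaus theorem, itself a consequence of Baire's theorem.

  In the limit the norm is weakly-\<open>\<star>\<close> lower semicontinuous, so the left-hand side causes no loss.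
  What remains is to bound \<open>J''(h\<^sub>k, h\<^sub>k)\<close> asymptotically by \<open>J''(h, h)\<close>
  (\<open>liminf_curvature_term_ge\<close>). Under weak-\<open>\<star>\<close> upper semicontinuity this is possible for
  every admissible sequence, hence for the infimum that defines the curvature. Under Mosco
  regularity one sequence attains the infimum and has \<open>t\<^sub>k r\<^sub>k \<rightarrow> 0\<close> in norm; for it \<open>h\<^sub>k \<rightarrow> h\<close>
  in norm and \<open>J''(h\<^sub>k, h\<^sub>k)\<close> converges by continuity alone.
\<close>

section \<open>Boundedness of weakly-\<open>\<star>\<close> convergent sequences\<close>

text \<open>Baire's theorem applied to the closed sets on which the family is bounded by \<open>n\<close>
  yields one such set containing a ball; differences of its points then
  bound the family on a neighbourhood of the origin.\<close>

lemma banach_steinhaus: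
  fixes f :: "'i \<Rightarrow> 'a::banach \<Rightarrow>\<^sub>L 'b::real_normed_vector"
  assumes pointwise: "\<And>x. \<exists>B. \<forall>i. norm (f i x) \<le> B"
  shows "\<exists>B. \<forall>i. norm (f i) \<le> B"
proof -
  define A where "A n = {x. \<forall>i. norm (f i x) \<le> real n}" for n
  have closed_A: "closed (A n)" for n
  proof -
    have "closed {x. norm (f i x) \<le> real n}" for i
      by (intro closed_Collect_le continuous_intros)
    then show ?thesis
      unfolding A_def by (rule closed_Collect_all)
  qed
  have covers: "\<Union>(range A) = UNIV"
  proof -
    have "x \<in> \<Union>(range A)" for x
    proof -
      obtain B where "\<forall>i. norm (f i x) \<le> B"
        using pointwise by blast
      moreover obtain n where "B \<le> real n"
        using real_arch_simple by blast
      ultimately have "x \<in> A n"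
        unfolding A_def by (auto intro: order_trans)
      then show ?thesis by blast
    qed
    then show ?thesis by blast
  qed
  have "\<exists>n. interior (A n) \<noteq> {}"
  proof (rule ccontr)
    assume "\<not> ?thesis"
    then have "euclidean interior_of \<Union>(range A) = {}"
      by (intro Baire_category_alt)
        (auto simp: completely_metrizable_space_euclidean closed_A)
    with covers show False by simp
  qed
  then obtain n x0 where "x0 \<in> interior (A n)" by blast
  then obtain e where e: "e > 0" and ball: "cball x0 e \<subseteq> A n"
    by (auto simp: mem_interior_cball)
  have small: "norm (f i z) \<le> 2 * real n" if "norm z \<le> e" for i z
  proof -
    have "x0 \<in> A n" "x0 + z \<in> A n"
      using ball e that by (auto simp: dist_norm)
    then have "norm (f i (x0 + z)) + norm (f i x0) \<le> 2 * real n"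
      unfolding A_def by (smt (verit) mem_Collect_eq)
    moreover have "f i z = f i (x0 + z) - f i x0"
      by (simp add: blinfun.add_right)
    ultimately show ?thesis
      by (metis norm_triangle_ineq4 order_trans)
  qed
  have "norm (f i) \<le> 2 * real n / e" for i
  proof (rule norm_blinfun_bound)
    show "norm (f i y) \<le> 2 * real n / e * norm y" for y
    proof (cases "y = 0")
      case False
      have "norm (f i ((e / norm y) *\<^sub>R y)) \<le> 2 * real n"
        using False e by (intro small) simp
      then show ?thesis
        using False e by (simp add: blinfun.scaleR_right field_simps)
    qed simp
  qed (use e in simp)
  then show ?thesis by blast
qed

lemma weak_star_convergent_bounded:
  fixes g :: "nat \<Rightarrow> 'y::banach dual"
  assumes "weak_star_tendsto g h"
  shows "\<exists>B. \<forall>k. norm (g k) \<le> B"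
proof (rule banach_steinhaus)
  fix y
  have "Bseq (\<lambda>k. g k y)"
    using assms by (auto simp: weak_star_tendsto_iff intro: convergent_imp_Bseq convergentI)
  then show "\<exists>B. \<forall>k. norm (g k y) \<le> B"
    by (auto simp: Bseq_def)
qed

section \<open>Weak-\<open>\<star>\<close> lower semicontinuity of the dual norm\<close>

text \<open>The dual norm is a supremum of evaluations: if \<open>M < \<parallel>h\<parallel>\<close>, some \<open>y\<close> has
  \<open>\<bar>h y\<bar> > M \<parallel>y\<parallel>\<close>, an open condition for pointwise convergence.\<close>

lemma weak_star_norm_lower_semicontinuous:
  fixes g :: "nat \<Rightarrow> 'y::real_normed_vector dual"
  assumes conv: "weak_star_tendsto g h" and M: "0 \<le> M" "M < norm h"
  shows "\<forall>\<^sub>F k in sequentially. M < norm (g k)"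
proof -
  obtain y where y: "M * norm y < norm (h y)"
    using norm_blinfun_bound[of M h] M by (meson not_le)
  have "(\<lambda>k. norm (g k y)) \<longlonglongrightarrow> norm (h y)"
    using conv by (intro tendsto_norm) (simp add: weak_star_tendsto_iff)
  then have "\<forall>\<^sub>F k in sequentially. M * norm y < norm (g k y)"
    using y by (rule order_tendstoD)
  then show ?thesis
  proof eventually_elim
    case (elim k)
    then have "M * norm y < norm (g k) * norm y"
      using norm_blinfun[of "g k" y] by linarith
    then show ?case
      by (simp add: mult_less_cancel_right)
  qed
qed

lemma weak_star_norm_squared_lower_semicontinuous:
  fixes g :: "nat \<Rightarrow> 'y::real_normed_vector dual"
  assumes conv: "weak_star_tendsto g h" and "c \<ge> 0" and "\<delta> > 0"
  shows "\<forall>\<^sub>F k in sequentially. c * (norm h)\<^sup>2 - \<delta> \<le> c * (norm (g k))\<^sup>2"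
proof (cases "h = 0")
  case True
  have "- \<delta> \<le> c * (norm (g k))\<^sup>2" for k
    using assms(2,3) by (smt (verit) mult_nonneg_nonneg zero_le_power2)
  with True show ?thesis by simp
next
  case False
  have "((\<lambda>M. c * M\<^sup>2) \<longlongrightarrow> c * (norm h)\<^sup>2) (at_left (norm h))"
    by (intro tendsto_intros)
  then have "\<forall>\<^sub>F M in at_left (norm h). c * (norm h)\<^sup>2 - \<delta> < c * M\<^sup>2"
    using \<open>\<delta> > 0\<close> by (intro order_tendstoD) auto
  moreover have "\<forall>\<^sub>F M in at_left (norm h). M \<in> {0<..<norm h}"
    using False by (intro eventually_at_left_real) simp
  ultimately have "\<forall>\<^sub>F M in at_left (norm h).
      c * (norm h)\<^sup>2 - \<delta> < c * M\<^sup>2 \<and> M \<in> {0<..<norm h}"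
    by (rule eventually_conj)
  then obtain M where M: "c * (norm h)\<^sup>2 - \<delta> < c * M\<^sup>2" "0 < M" "M < norm h"
    using eventually_happens[of _ "at_left (norm h)"] by (auto simp: trivial_limit_at_left_real)
  have "\<forall>\<^sub>F k in sequentially. M < norm (g k)"
    using conv M by (intro weak_star_norm_lower_semicontinuous) auto
  then show ?thesis
  proof eventually_elim
    case (elim k)
    then have "c * M\<^sup>2 \<le> c * (norm (g k))\<^sup>2"
      using M \<open>c \<ge> 0\<close> by (intro mult_left_mono power_mono) auto
    with M show ?case by linarith
  qed
qed

section \<open>Growth along second-order curves\<close>

lemma perturbed_direction_weak_star_tendsto:
  assumes "weak_star_tendsto (\<lambda>k. t k *\<^sub>R r k) 0"
  shows "weak_star_tendsto (\<lambda>k. h + (t k / 2) *\<^sub>R r k) h"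
  unfolding weak_star_tendsto_iff
proof
  fix y
  have "(\<lambda>k. t k * r k y) \<longlonglongrightarrow> 0"
    using assms by (simp add: weak_star_tendsto_iff blinfun.scaleR_left)
  then have "(\<lambda>k. h y + 1 / 2 * (t k * r k y)) \<longlonglongrightarrow> h y + 1 / 2 * 0"
    by (intro tendsto_intros)
  then show "(\<lambda>k. (h + (t k / 2) *\<^sub>R r k) y) \<longlonglongrightarrow> h y"
    by (simp add: blinfun.add_left blinfun.scaleR_left)
qed

text \<open>The term \<open>2 e\<^sub>k\<close> below is the remainder of the expansion, scaled by the factor that
  turns \<open>t\<^sub>k\<^sup>2\<close> into \<open>t\<^sub>k\<^sup>2/2\<close>. The bound is only eventual because growth is local.\<close>

lemma growth_along_curve:
  fixes C :: "'y::banach dual set"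
  assumes expansion: "second_order_expansion C J x J1 J2"
    and "\<epsilon> > 0"
    and growth: "\<forall>z \<in> C \<inter> cball x \<epsilon>. J z \<ge> J x + c / 2 * (norm (z - x))\<^sup>2"
    and h: "J1 h = 0"
    and t: "pos_null_seq t"
    and tr: "weak_star_tendsto (\<lambda>k. t k *\<^sub>R r k) 0"
    and curve: "\<forall>k. x + t k *\<^sub>R h + (1/2 * (t k)\<^sup>2) *\<^sub>R r k \<in> C"
  defines "g \<equiv> \<lambda>k. h + (t k / 2) *\<^sub>R r k"
  shows "\<exists>e. e \<longlonglongrightarrow> 0 \<and>
    (\<forall>\<^sub>F k in sequentially. c * (norm (g k))\<^sup>2 \<le> J1 (r k) + J2 (g k) (g k) + 2 * e k)"
proof -
  have conv: "weak_star_tendsto g h"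
    unfolding g_def using tr by (rule perturbed_direction_weak_star_tendsto)
  have t_lim: "t \<longlonglongrightarrow> 0" and t_pos: "\<And>k. t k > 0"
    using t by (auto simp: pos_null_seq_def)
  have "x + t k *\<^sub>R g k = x + t k *\<^sub>R h + (1/2 * (t k)\<^sup>2) *\<^sub>R r k" for k
    by (simp add: g_def scaleR_add_right power2_eq_square)
  with curve have in_C: "x + t k *\<^sub>R g k \<in> C" for k
    by (simp add: add.assoc)
  define e where "e k = (J (x + t k *\<^sub>R g k) - J x - t k * J1 (g k)
      - 1/2 * (t k)\<^sup>2 * J2 (g k) (g k)) / (t k)\<^sup>2" for k
  have e_lim: "e \<longlonglongrightarrow> 0"
    using expansion t conv in_C unfolding second_order_expansion_def e_def by blast
  obtain B where B: "\<forall>k. norm (g k) \<le> B"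
    using weak_star_convergent_bounded[OF conv] by blast
  have "(\<lambda>k. t k * B) \<longlonglongrightarrow> 0"
    using t_lim by (rule tendsto_mult_left_zero)
  then have "\<forall>\<^sub>F k in sequentially. t k * B < \<epsilon>"
    using \<open>\<epsilon> > 0\<close> by (rule order_tendstoD)
  then have "\<forall>\<^sub>F k in sequentially. c * (norm (g k))\<^sup>2 \<le> J1 (r k) + J2 (g k) (g k) + 2 * e k"
  proof eventually_elim
    case (elim k)
    have "t k * norm (g k) \<le> t k * B"
      using B t_pos[of k] by (intro mult_left_mono) auto
    with elim have "t k * norm (g k) \<le> \<epsilon>"
      by linarith
    then have "x + t k *\<^sub>R g k \<in> C \<inter> cball x \<epsilon>"
      using in_C t_pos[of k] by (simp add: dist_norm)
    then have "J x + c / 2 * (norm (x + t k *\<^sub>R g k - x))\<^sup>2 \<le> J (x + t k *\<^sub>R g k)"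
      by (rule growth[rule_format])
    then have "J x + c / 2 * ((t k)\<^sup>2 * (norm (g k))\<^sup>2) \<le> J (x + t k *\<^sub>R g k)"
      by (simp add: power_mult_distrib)
    moreover have "J (x + t k *\<^sub>R g k) - J x =
        t k * J1 (g k) + 1/2 * (t k)\<^sup>2 * J2 (g k) (g k) + (t k)\<^sup>2 * e k"
      using t_pos[of k] by (simp add: e_def)
    moreover have "t k * J1 (g k) = (t k)\<^sup>2 / 2 * J1 (r k)"
      by (simp add: g_def blinfun.add_right blinfun.scaleR_right h power2_eq_square)
    ultimately have "(t k)\<^sup>2 * (c * (norm (g k))\<^sup>2) \<le>
        (t k)\<^sup>2 * (J1 (r k) + J2 (g k) (g k) + 2 * e k)"
      by (simp add: algebra_simps)
    then show ?case
      using t_pos[of k] by (simp add: mult_le_cancel_left)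
  qed
  with e_lim show ?thesis by blast
qed

text \<open>Both sufficient conditions enter the argument only as the asymptotic upper bound \<open>upper\<close> on the
  quadratic form along one given sequence.\<close>

lemma liminf_curvature_term_ge:
  fixes C :: "'y::banach dual set"
  assumes expansion: "second_order_expansion C J x J1 J2"
    and "c \<ge> 0" and "\<epsilon> > 0"
    and growth: "\<forall>z \<in> C \<inter> cball x \<epsilon>. J z \<ge> J x + c / 2 * (norm (z - x))\<^sup>2"
    and h: "J1 h = 0"
    and t: "pos_null_seq t"
    and tr: "weak_star_tendsto (\<lambda>k. t k *\<^sub>R r k) 0"
    and curve: "\<forall>k. x + t k *\<^sub>R h + (1/2 * (t k)\<^sup>2) *\<^sub>R r k \<in> C"
    and upper: "limsup (\<lambda>k. ereal (J2 (h + (t k / 2) *\<^sub>R r k) (h + (t k / 2) *\<^sub>R r k)))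
      \<le> ereal (J2 h h)"
  shows "ereal (c * (norm h)\<^sup>2 - J2 h h) \<le> liminf (\<lambda>k. ereal (J1 (r k)))"
proof -
  define g where "g k = h + (t k / 2) *\<^sub>R r k" for k
  obtain e where e_lim: "e \<longlonglongrightarrow> 0"
    and e: "\<forall>\<^sub>F k in sequentially. c * (norm (g k))\<^sup>2 \<le> J1 (r k) + J2 (g k) (g k) + 2 * e k"
    using growth_along_curve[OF expansion \<open>\<epsilon> > 0\<close> growth h t tr curve] unfolding g_def by blast
  have conv: "weak_star_tendsto g h"
    unfolding g_def using tr by (rule perturbed_direction_weak_star_tendsto)
  have "ereal (c * (norm h)\<^sup>2 - J2 h h) \<le> liminf (\<lambda>k. ereal (J1 (r k))) + ereal \<delta>"
    if "\<delta> > 0" for \<delta>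
  proof -
    \<comment> \<open>The three errors, from the norm, the quadratic form and twice the remainder, share \<open>\<delta>\<close>.\<close>
    have "\<forall>\<^sub>F k in sequentially. c * (norm h)\<^sup>2 - \<delta> / 4 \<le> c * (norm (g k))\<^sup>2"
      using conv \<open>c \<ge> 0\<close> that by (intro weak_star_norm_squared_lower_semicontinuous) auto
    moreover have "limsup (\<lambda>k. ereal (J2 (g k) (g k))) < ereal (J2 h h + \<delta> / 4)"
      using upper that unfolding g_def by (rule_tac le_less_trans) auto
    then have "\<forall>\<^sub>F k in sequentially. ereal (J2 (g k) (g k)) < ereal (J2 h h + \<delta> / 4)"
      by (rule Limsup_lessD)
    moreover have "\<forall>\<^sub>F k in sequentially. e k < \<delta> / 4"
      using e_lim that by (intro order_tendstoD) auto
    ultimately have "\<forall>\<^sub>F k in sequentially.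
        ereal (c * (norm h)\<^sup>2 - J2 h h - \<delta>) \<le> ereal (J1 (r k))"
      using e
    proof eventually_elim
      case (elim k)
      then have "J2 (g k) (g k) < J2 h h + \<delta> / 4"
        by simp
      with elim(1,3,4) have "c * (norm h)\<^sup>2 - J2 h h - \<delta> \<le> J1 (r k)"
        by linarith
      then show ?case by simp
    qed
    then have "ereal (c * (norm h)\<^sup>2 - J2 h h - \<delta>) \<le> liminf (\<lambda>k. ereal (J1 (r k)))"
      by (rule Liminf_bounded)
    then have "ereal (c * (norm h)\<^sup>2 - J2 h h - \<delta>) + ereal \<delta>
        \<le> liminf (\<lambda>k. ereal (J1 (r k))) + ereal \<delta>"
      by (rule add_right_mono)
    then show ?thesis by simp
  qed
  then show ?thesis
    by (rule ereal_le_epsilon2)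
qed

section \<open>The second-order necessary condition\<close>

text \<open>Along a Mosco sequence \<open>h\<^sub>k \<rightarrow> h\<close> in norm, so that boundedness of the form is enough.\<close>

lemma strong_limsup_quadratic_form:
  fixes J2 :: "'a::real_normed_vector \<Rightarrow> 'a \<Rightarrow> real"
  assumes "bounded_bilinear J2" and tr: "(\<lambda>k. t k *\<^sub>R r k) \<longlonglongrightarrow> 0"
  shows "limsup (\<lambda>k. ereal (J2 (h + (t k / 2) *\<^sub>R r k) (h + (t k / 2) *\<^sub>R r k)))
    \<le> ereal (J2 h h)"
proof -
  have "(\<lambda>k. h + (1 / 2) *\<^sub>R (t k *\<^sub>R r k)) \<longlonglongrightarrow> h + (1 / 2) *\<^sub>R 0"
    by (intro tendsto_intros tr)
  then have h_lim: "(\<lambda>k. h + (t k / 2) *\<^sub>R r k) \<longlonglongrightarrow> h"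
    by simp
  have "(\<lambda>k. J2 (h + (t k / 2) *\<^sub>R r k) (h + (t k / 2) *\<^sub>R r k)) \<longlonglongrightarrow> J2 h h"
    by (rule bounded_bilinear.tendsto[OF assms(1) h_lim h_lim])
  then have "(\<lambda>k. ereal (J2 (h + (t k / 2) *\<^sub>R r k) (h + (t k / 2) *\<^sub>R r k)))
      \<longlonglongrightarrow> ereal (J2 h h)"
    by (rule tendsto_ereal)
  then have "limsup (\<lambda>k. ereal (J2 (h + (t k / 2) *\<^sub>R r k) (h + (t k / 2) *\<^sub>R r k)))
      = ereal (J2 h h)"
    by (intro lim_imp_Limsup) auto
  then show ?thesis by simp
qed

lemma norm_tendsto_imp_weak_star_tendsto:
  assumes "g \<longlonglongrightarrow> h"
  shows "weak_star_tendsto g h"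
  unfolding weak_star_tendsto_iff by (intro allI blinfun.tendsto[OF assms tendsto_const])

theorem theorem4p3:
  fixes C :: "'y::banach dual set"
    and J :: "'y dual \<Rightarrow> real"
    and xbar :: "'y dual"
    and J1 :: "'y dual dual"
    and J2 :: "'y dual \<Rightarrow> 'y dual \<Rightarrow> real"
    and c \<epsilon> :: real
  assumes separable: "separable_space (euclidean :: 'y topology)"
    and C: "closed C" "C \<noteq> {}" "xbar \<in> C"
    and J1: "J1 \<in> range canonical_embedding"
    and J2: "bounded_bilinear J2"
    and expansion: "second_order_expansion C J xbar J1 J2"
    and local_min: "local_minimizer_on J C xbar"
    and "c \<ge> 0" and "\<epsilon> > 0"
    and growth: "\<forall>x \<in> C \<inter> cball xbar \<epsilon>. J x \<ge> J xbar + c / 2 * (norm (x - xbar))\<^sup>2"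
    and cond: "weak_star_usc (\<lambda>h. J2 h h) \<or> mosco_regularity C xbar J1"
  shows "\<forall>h \<in> critical_cone C xbar J1.
           directional_curvature C xbar J1 h + ereal (J2 h h) \<ge> ereal (c * (norm h)\<^sup>2)"
proof
  fix h assume h_crit: "h \<in> critical_cone C xbar J1"
  then have h: "J1 h = 0"
    by (simp add: critical_cone_def)
  note liminf_ge = liminf_curvature_term_ge[OF expansion \<open>c \<ge> 0\<close> \<open>\<epsilon> > 0\<close> growth h]
  from cond have "ereal (c * (norm h)\<^sup>2 - J2 h h) \<le> directional_curvature C xbar J1 h"
  proof
    assume usc: "weak_star_usc (\<lambda>h. J2 h h)"
    show ?thesis
      unfolding directional_curvature_def
    proof (rule Inf_greatest, clarify)
      fix r t
      assume t: "pos_null_seq t" and tr: "weak_star_tendsto (\<lambda>k. t k *\<^sub>R r k) 0"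
        and curve: "\<forall>k. xbar + t k *\<^sub>R h + (1/2 * (t k)\<^sup>2) *\<^sub>R r k \<in> C"
      have "limsup (\<lambda>k. ereal (J2 (h + (t k / 2) *\<^sub>R r k) (h + (t k / 2) *\<^sub>R r k)))
          \<le> ereal (J2 h h)"
        using usc perturbed_direction_weak_star_tendsto[OF tr, of h]
        unfolding weak_star_usc_def by blast
      with t tr curve show "ereal (c * (norm h)\<^sup>2 - J2 h h) \<le> liminf (\<lambda>k. ereal (J1 (r k)))"
        by (rule liminf_ge)
    qed
  next
    assume "mosco_regularity C xbar J1"
    then obtain r t where t: "pos_null_seq t" and tr: "(\<lambda>k. t k *\<^sub>R r k) \<longlonglongrightarrow> 0"
      and curve: "\<forall>k. xbar + t k *\<^sub>R h + (1/2 * (t k)\<^sup>2) *\<^sub>R r k \<in> C"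
      and Q: "(\<lambda>k. ereal (J1 (r k))) \<longlonglongrightarrow> directional_curvature C xbar J1 h"
      using h_crit unfolding mosco_regularity_def by blast
    have "ereal (c * (norm h)\<^sup>2 - J2 h h) \<le> liminf (\<lambda>k. ereal (J1 (r k)))"
      using t norm_tendsto_imp_weak_star_tendsto[OF tr] curve strong_limsup_quadratic_form[OF J2 tr]
      by (rule liminf_ge)
    also have "\<dots> = directional_curvature C xbar J1 h"
      using Q by (intro lim_imp_Liminf) auto
    finally show ?thesis .
  qed
  then have "ereal (c * (norm h)\<^sup>2 - J2 h h) + ereal (J2 h h)
      \<le> directional_curvature C xbar J1 h + ereal (J2 h h)"
    by (rule add_right_mono)
  then show "ereal (c * (norm h)\<^sup>2) \<le> directional_curvature C xbar J1 h + ereal (J2 h h)"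
    by simp
qed

end
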